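(* Let $X,Y$ be two totally ordered sets, let $R\subseteq R'\subseteq X\times Y$ be two nonempty relations, and let $E_R,F_R,E_{R'},F_{R'}$ be their associated simplicial complexes. Let $\iota_E:F_R\hookrightarrow F_{R'}$ and $\iota_F:E_R\hookrightarrow E_{R'}$ denote the canonical inclusions. Then there exist homotopy equivalences $\Gamma_{|E_R|}:|F_R|\to|E_R|$ and $\Gamma_{|E_{R'}|}:|F_{R'}|\to|E_{R'}|$ such that $$|\iota_F|\circ\Gamma_{|E_R|}\simeq\Gamma_{|E_{R'}|}\circ|\iota_E|$$ as maps $|F_R|\to|E_{R'}|$ (homotopic maps).
   Context: For a nonempty relation $R\subseteq X\times Y$, the simplicial complexes $E_R$ and $F_R$ are defined as follows. A (nonempty) finite subset $\sigma\subseteq X$ is a simplex of $E_R$ whenever there exists $y\in Y$ such that $(x,y)\in R$ for each $x\in\sigma$. A (nonempty) finite subset $\tau\subseteq Y$ is a simplex of $F_R$ whenever there exists $x\in X$ such that $(x,y)\in R$ for each $y\in\tau$. The complexes may be infinite. $|\Sigma|$ denotes the geometric realization of a simplicial complex $\Sigma$ with the weak topology (a subset is closed iff its intersection with each closed simplex is closed), and $|f|$ denotes the map on geometric realizations induced by a simplicial map $f$ by linear extension. $\simeq$ denotes homotopy of maps. *)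

theory Defs
  imports "HOL-Analysis.Analysis"
begin

definition dowker_E :: "'a set \<Rightarrow> 'b set \<Rightarrow> ('a \<times> 'b) set \<Rightarrow> 'a set set" where
  "dowker_E X Y R =
     {\<sigma>. finite \<sigma> \<and> \<sigma> \<noteq> {} \<and> \<sigma> \<subseteq> X \<and> (\<exists>y\<in>Y. \<forall>x\<in>\<sigma>. (x, y) \<in> R)}"

definition dowker_F :: "'a set \<Rightarrow> 'b set \<Rightarrow> ('a \<times> 'b) set \<Rightarrow> 'b set set" where
  "dowker_F X Y R =
     {\<tau>. finite \<tau> \<and> \<tau> \<noteq> {} \<and> \<tau> \<subseteq> Y \<and> (\<exists>x\<in>X. \<forall>y\<in>\<tau>. (x, y) \<in> R)}"

text \<open>
  A simplicial complex is given by its set of simplices (finite nonempty sets of vertices).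
  Points of its realization are barycentric coordinates, extended by zero to all of
  the vertex type.
\<close>

definition closed_simplex :: "'v set \<Rightarrow> ('v \<Rightarrow> real) set" where
  "closed_simplex \<sigma> =
     {t. (\<forall>v. 0 \<le> t v) \<and> (\<forall>v. v \<notin> \<sigma> \<longrightarrow> t v = 0) \<and> (\<Sum>v\<in>\<sigma>. t v) = 1}"

text \<open>
  For finite \<open>\<sigma>\<close> the product topology induces on the closed simplex its Euclidean topology.
\<close>

definition closed_simplex_topology :: "'v set \<Rightarrow> ('v \<Rightarrow> real) topology" where
  "closed_simplex_topology \<sigma> = subtopology (powertop_real UNIV) (closed_simplex \<sigma>)"

text \<open>
  The weak topology, given by its open sets; \<open>closedin_realization\<close> below is the
  description by closed sets.
\<close>

definition realization :: "'v set set \<Rightarrow> ('v \<Rightarrow> real) topology" where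
  "realization K = topology (\<lambda>U. U \<subseteq> (\<Union>\<sigma>\<in>K. closed_simplex \<sigma>) \<and>
     (\<forall>\<sigma>\<in>K. openin (closed_simplex_topology \<sigma>) (U \<inter> closed_simplex \<sigma>)))"

text \<open>
  The linear extension of a vertex map. On points of a realization the sum is finite.
\<close>

definition realization_map :: "('v \<Rightarrow> 'w) \<Rightarrow> ('v \<Rightarrow> real) \<Rightarrow> ('w \<Rightarrow> real)" where
  "realization_map f t = (\<lambda>w. \<Sum>v | t v \<noteq> 0 \<and> f v = w. t v)"

definition homotopy_equivalence_map ::
    "'a topology \<Rightarrow> 'b topology \<Rightarrow> ('a \<Rightarrow> 'b) \<Rightarrow> bool" where
  "homotopy_equivalence_map S T f \<longleftrightarrow> continuous_map S T f \<and>
     (\<exists>g. continuous_map T S g \<and>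
          homotopic_with (\<lambda>_. True) S S (g \<circ> f) id \<and>
          homotopic_with (\<lambda>_. True) T T (f \<circ> g) id)"

lemma topspace_closed_simplex_topology [simp]:
  "topspace (closed_simplex_topology \<sigma>) = closed_simplex \<sigma>"
  by (simp add: closed_simplex_topology_def)

lemma openin_realization:
  "openin (realization K) U \<longleftrightarrow> U \<subseteq> (\<Union>\<sigma>\<in>K. closed_simplex \<sigma>) \<and>
     (\<forall>\<sigma>\<in>K. openin (closed_simplex_topology \<sigma>) (U \<inter> closed_simplex \<sigma>))"
proof -
  have "istopology (\<lambda>U. U \<subseteq> (\<Union>\<sigma>\<in>K. closed_simplex \<sigma>) \<and>
     (\<forall>\<sigma>\<in>K. openin (closed_simplex_topology \<sigma>) (U \<inter> closed_simplex \<sigma>)))"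
    (is "istopology ?P")
    unfolding istopology_def
  proof (intro conjI allI impI)
    fix U V assume U: "?P U" and V: "?P V"
    show "U \<inter> V \<subseteq> (\<Union>\<sigma>\<in>K. closed_simplex \<sigma>)"
      using U by blast
    have "U \<inter> V \<inter> closed_simplex \<sigma> = (U \<inter> closed_simplex \<sigma>) \<inter> (V \<inter> closed_simplex \<sigma>)"
      for \<sigma> by blast
    then show "\<forall>\<sigma>\<in>K. openin (closed_simplex_topology \<sigma>) (U \<inter> V \<inter> closed_simplex \<sigma>)"
      using U V by auto
  next
    fix \<U> assume \<U>: "\<forall>U\<in>\<U>. ?P U"
    show "\<Union>\<U> \<subseteq> (\<Union>\<sigma>\<in>K. closed_simplex \<sigma>)"
      using \<U> by blast
    show "\<forall>\<sigma>\<in>K. openin (closed_simplex_topology \<sigma>) (\<Union>\<U> \<inter> closed_simplex \<sigma>)"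
    proof
      fix \<sigma> assume "\<sigma> \<in> K"
      then have "openin (closed_simplex_topology \<sigma>) (\<Union>U\<in>\<U>. U \<inter> closed_simplex \<sigma>)"
        using \<U> by (intro openin_Union) auto
      moreover have "\<Union>\<U> \<inter> closed_simplex \<sigma> = (\<Union>U\<in>\<U>. U \<inter> closed_simplex \<sigma>)"
        by blast
      ultimately show "openin (closed_simplex_topology \<sigma>) (\<Union>\<U> \<inter> closed_simplex \<sigma>)"
        by (simp only:)
    qed
  qed
  then show ?thesis
    unfolding realization_def by (subst topology_inverse') (assumption, rule refl)
qed

lemma topspace_realization [simp]:
  "topspace (realization K) = (\<Union>\<sigma>\<in>K. closed_simplex \<sigma>)"
proof (rule antisym)
  show "topspace (realization K) \<subseteq> (\<Union>\<sigma>\<in>K. closed_simplex \<sigma>)"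
    by (rule conjunct1[OF iffD1[OF openin_realization openin_topspace]])
  have "openin (closed_simplex_topology \<sigma>) ((\<Union>\<sigma>\<in>K. closed_simplex \<sigma>) \<inter> closed_simplex \<sigma>)"
    if "\<sigma> \<in> K" for \<sigma>
  proof -
    have "(\<Union>\<sigma>\<in>K. closed_simplex \<sigma>) \<inter> closed_simplex \<sigma> = closed_simplex \<sigma>"
      using that by blast
    then show ?thesis
      using openin_topspace[of "closed_simplex_topology \<sigma>"] by simp
  qed
  then have "openin (realization K) (\<Union>\<sigma>\<in>K. closed_simplex \<sigma>)"
    unfolding openin_realization by blast
  then show "(\<Union>\<sigma>\<in>K. closed_simplex \<sigma>) \<subseteq> topspace (realization K)"
    by (rule openin_subset)
qed

lemma closedin_realization:
  "closedin (realization K) C \<longleftrightarrow> C \<subseteq> (\<Union>\<sigma>\<in>K. closed_simplex \<sigma>) \<and>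
     (\<forall>\<sigma>\<in>K. closedin (closed_simplex_topology \<sigma>) (C \<inter> closed_simplex \<sigma>))"
proof -
  have "openin (closed_simplex_topology \<sigma>)
          (((\<Union>\<sigma>\<in>K. closed_simplex \<sigma>) - C) \<inter> closed_simplex \<sigma>) \<longleftrightarrow>
        closedin (closed_simplex_topology \<sigma>) (C \<inter> closed_simplex \<sigma>)" if "\<sigma> \<in> K" for \<sigma>
  proof -
    have "((\<Union>\<sigma>\<in>K. closed_simplex \<sigma>) - C) \<inter> closed_simplex \<sigma>
        = closed_simplex \<sigma> - C \<inter> closed_simplex \<sigma>"
      using that by blast
    then show ?thesis
      by (simp add: closedin_def)
  qed
  then show ?thesis
    unfolding closedin_def[of "realization K"] openin_realization topspace_realization
    by blast
qed

lemma realization_map_id: "realization_map id t = t"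
proof
  fix w
  have "{v. t v \<noteq> 0 \<and> id v = w} = (if t w = 0 then {} else {w})"
    by auto
  then show "realization_map id t w = t w"
    by (simp add: realization_map_def)
qed

lemma dowker_mono:
  assumes "R \<subseteq> R'"
  shows "dowker_E X Y R \<subseteq> dowker_E X Y R'" and "dowker_F X Y R \<subseteq> dowker_F X Y R'"
  using assms by (fastforce simp: dowker_E_def dowker_F_def)+

end

theory Submission
  imports Defs
begin

text \<open>
  Both \<open>|E\<^sub>R|\<close> and \<open>|F\<^sub>R|\<close> are deformation retracts of the realization of one complex \<open>K\<^sub>R\<close> on the
  disjoint union of the vertices, with simplices \<open>\<sigma> \<squnion> \<tau>\<close> such that \<open>\<sigma> \<times> \<tau> \<subseteq> R\<close>, where \<open>\<sigma>\<close> and \<open>\<tau>\<close> are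
  simplices of \<open>E\<^sub>R\<close> and \<open>F\<^sub>R\<close> or empty.
  To deform \<open>|K\<^sub>R|\<close> into \<open>|E\<^sub>R|\<close>, choose a witness \<open>x(\<tau>)\<close> for every simplex \<open>\<tau>\<close> of \<open>F\<^sub>R\<close>. At time \<open>\<theta>\<close> a
  point \<open>(s, t)\<close> is sent, up to normalisation, to \<open>s + P(min(t, \<theta>)) + (t - \<theta>)\<^sup>+\<close>, where \<open>P\<close> distributes
  mass over the witnesses of the superlevel sets of its argument. The superlevel sets of \<open>min(t, \<theta>)\<close>
  all contain \<open>{t > \<theta>}\<close>, so their witnesses are related to every vertex that has not been moved yet.
  With inclusions \<open>i\<^sub>R : |E\<^sub>R| \<rightarrow> |K\<^sub>R|\<close>, \<open>j\<^sub>R : |F\<^sub>R| \<rightarrow> |K\<^sub>R|\<close> and the retraction \<open>r\<^sub>R\<close> to \<open>|E\<^sub>R|\<close>, the map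
  \<open>\<Gamma> = r\<^sub>R j\<^sub>R\<close> is an equivalence, and inside \<open>|K\<^sub>R\<^sub>'|\<close> we have
  \<open>r\<^sub>R j\<^sub>R = r\<^sub>R\<^sub>' i\<^sub>R r\<^sub>R j\<^sub>R \<simeq> r\<^sub>R\<^sub>' j\<^sub>R\<close>.
\<close>

subsection \<open>Continuity for the weak topology\<close>

lemma continuous_map_realizationI:
  assumes "\<And>\<sigma>. \<sigma> \<in> K \<Longrightarrow> continuous_map (closed_simplex_topology \<sigma>) W f"
  shows "continuous_map (realization K) W f"
  unfolding continuous_map
proof (intro conjI allI impI)
  show "f ` topspace (realization K) \<subseteq> topspace W"
    using assms by (fastforce simp: continuous_map)
next
  fix U assume U: "openin W U"
  have "openin (closed_simplex_topology \<sigma>)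
          ({x \<in> topspace (realization K). f x \<in> U} \<inter> closed_simplex \<sigma>)" if "\<sigma> \<in> K" for \<sigma>
  proof -
    have "{x \<in> topspace (realization K). f x \<in> U} \<inter> closed_simplex \<sigma>
        = {x \<in> topspace (closed_simplex_topology \<sigma>). f x \<in> U}"
      using that by auto
    then show ?thesis
      using assms[OF that] U by (simp add: continuous_map)
  qed
  then show "openin (realization K) {x \<in> topspace (realization K). f x \<in> U}"
    by (auto simp: openin_realization)
qed

text \<open>A set is open in the weak topology exactly when its trace on every closed simplex is
  open, which is the quotient condition for the disjoint union of the simplices. This form is needed
  to control products with an interval.\<close>

lemma quotient_map_realization:
  "quotient_map (sum_topology closed_simplex_topology K) (realization K) snd"
  unfolding quotient_map_def
proof (intro conjI allI impI)
  show "snd ` topspace (sum_topology closed_simplex_topology K) = topspace (realization K)"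
    by force
next
  fix U assume U: "U \<subseteq> topspace (realization K)"
  have "{x. (\<sigma>, x) \<in> {x \<in> topspace (sum_topology closed_simplex_topology K). snd x \<in> U}}
      = U \<inter> closed_simplex \<sigma>" if "\<sigma> \<in> K" for \<sigma>
    using that by auto
  then show "openin (sum_topology closed_simplex_topology K)
               {x \<in> topspace (sum_topology closed_simplex_topology K). snd x \<in> U}
             \<longleftrightarrow> openin (realization K) U"
    using U by (auto simp: openin_sum_topology openin_realization)
qed

text \<open>The slabs \<open>?S i\<close> form an open cover of the product, so continuity can be
  pasted from the summands.\<close>

lemma continuous_map_prod_sum_topology:
  assumes "\<And>i. i \<in> I \<Longrightarrow> continuous_map (prod_topology Z (T i)) W (\<lambda>(z, x). h (z, i, x))"
  shows "continuous_map (prod_topology Z (sum_topology T I)) W h"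
proof (rule pasting_lemma)
  let ?S = "\<lambda>i. topspace Z \<times> ({i} \<times> topspace (T i))"
  show "openin (prod_topology Z (sum_topology T I)) (?S i)" if "i \<in> I" for i
  proof -
    have "open_map (T i) (sum_topology T I) (\<lambda>x. (i, x))"
      by (rule open_map_component_injection[OF that])
    then have "openin (sum_topology T I) ((\<lambda>x. (i, x)) ` topspace (T i))"
      unfolding open_map_def by blast
    moreover have "(\<lambda>x. (i, x)) ` topspace (T i) = {i} \<times> topspace (T i)"
      by auto
    ultimately show ?thesis
      by (simp add: openin_prod_Times_iff)
  qed
  show "continuous_map (subtopology (prod_topology Z (sum_topology T I)) (?S i)) W h"
    if i: "i \<in> I" for i
  proof -
    \<comment> \<open>On one summand \<open>snd\<close> inverts the injection of \<open>T i\<close>,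
      which is an open map.\<close>
    have snd: "continuous_map (subtopology (sum_topology T I) ({i} \<times> topspace (T i))) (T i) snd"
      unfolding continuous_map
    proof (intro conjI allI impI)
      fix U assume U: "openin (T i) U"
      have "openin (sum_topology T I) ((\<lambda>x. (i, x)) ` U)"
        using open_map_component_injection[OF i] U unfolding open_map_def by blast
      moreover have "{x \<in> topspace (subtopology (sum_topology T I) ({i} \<times> topspace (T i))).
              snd x \<in> U} = (\<lambda>x. (i, x)) ` U \<inter> ({i} \<times> topspace (T i))"
        using i openin_subset[OF U] by auto
      ultimately show "openin (subtopology (sum_topology T I) ({i} \<times> topspace (T i)))
              {x \<in> topspace (subtopology (sum_topology T I) ({i} \<times> topspace (T i))). snd x \<in> U}"
        by (simp add: openin_subtopology_Int)
    qed auto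
    have "continuous_map (prod_topology Z (subtopology (sum_topology T I) ({i} \<times> topspace (T i))))
            (prod_topology Z (T i)) (\<lambda>(z, p). (id z, snd p))"
      using snd by (simp add: continuous_map_prod_top)
    from continuous_map_compose[OF this assms[OF i]]
    have "continuous_map (prod_topology Z (subtopology (sum_topology T I) ({i} \<times> topspace (T i))))
            W h"
      by (rule continuous_map_eq) (use i in auto)
    moreover have "subtopology (prod_topology Z (sum_topology T I)) (?S i)
        = prod_topology Z (subtopology (sum_topology T I) ({i} \<times> topspace (T i)))"
      by (simp only: subtopology_Times subtopology_topspace)
    ultimately show ?thesis
      by simp
  qed
qed auto

text \<open>Multiplying a quotient map by a locally compact Hausdorff space yields a quotient map
  again. With \<open>Z\<close> the unit interval, homotopies on a realization can thus be checked
  one simplex at a time, even for infinite complexes.\<close>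

lemma continuous_map_prod_realizationI:
  assumes "locally_compact_space Z" "Hausdorff_space Z"
    and "\<And>\<sigma>. \<sigma> \<in> K \<Longrightarrow> continuous_map (prod_topology Z (closed_simplex_topology \<sigma>)) W h"
  shows "continuous_map (prod_topology Z (realization K)) W h"
proof -
  have "quotient_map (prod_topology Z (sum_topology closed_simplex_topology K))
          (prod_topology Z (realization K)) (\<lambda>(z, p). (z, snd p))"
    using assms(1,2) quotient_map_realization by (intro quotient_map_prod_right) auto
  moreover have "continuous_map (prod_topology Z (sum_topology closed_simplex_topology K)) W
                   (h \<circ> (\<lambda>(z, p). (z, snd p)))"
    by (rule continuous_map_prod_sum_topology) (use assms(3) in \<open>auto simp: o_def\<close>)
  ultimately show ?thesis
    using continuous_compose_quotient_map_eq by blast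
qed

lemma closedin_closed_simplex:
  assumes "finite \<sigma>"
  shows "closedin (powertop_real UNIV) (closed_simplex \<sigma>)"
proof -
  let ?P = "powertop_real (UNIV :: 'a set)"
  have proj: "continuous_map ?P euclideanreal (\<lambda>t. t v)" for v :: 'a
    by (intro continuous_map_product_projection) simp
  have "closedin ?P {t \<in> topspace ?P. t v \<in> {0..}}" for v :: 'a
    by (rule closedin_continuous_map_preimage[OF proj]) simp
  moreover have "closedin ?P {t \<in> topspace ?P. t v \<in> {0}}" for v :: 'a
    by (rule closedin_continuous_map_preimage[OF proj]) simp
  moreover have "closedin ?P {t \<in> topspace ?P. (\<Sum>v\<in>\<sigma>. t v) \<in> {1}}"
    by (rule closedin_continuous_map_preimage[OF continuous_map_sum]) (use proj assms in auto)
  moreover have "closedin ?P (topspace ?P)"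
    by (rule closedin_topspace)
  \<comment> \<open>Vertices of \<open>\<sigma>\<close> contribute the whole space, so the
    intersection runs over the nonempty set \<open>UNIV\<close> even if \<open>\<sigma>\<close>
    exhausts the vertex type.\<close>
  ultimately have "closedin ?P ((\<Inter>v\<in>UNIV. {t \<in> topspace ?P. t v \<in> {0..}})
      \<inter> (\<Inter>v\<in>UNIV. if v \<in> \<sigma> then topspace ?P else {t \<in> topspace ?P. t v \<in> {0}})
      \<inter> {t \<in> topspace ?P. (\<Sum>v\<in>\<sigma>. t v) \<in> {1}})"
    by (intro closedin_Int closedin_INT) (auto simp del: topspace_product_topology)
  moreover have "((\<Inter>v\<in>UNIV. {t \<in> topspace ?P. t v \<in> {0..}})
      \<inter> (\<Inter>v\<in>UNIV. if v \<in> \<sigma> then topspace ?P else {t \<in> topspace ?P. t v \<in> {0}})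
      \<inter> {t \<in> topspace ?P. (\<Sum>v\<in>\<sigma>. t v) \<in> {1}}) = closed_simplex \<sigma>"
    by (auto simp: closed_simplex_def split: if_splits)
  ultimately show ?thesis
    by simp
qed

text \<open>
  Compact sets lie in finite subcomplexes, so confining the image to the simplices with
  vertices in a fixed finite set loses nothing; on a finite subcomplex the weak topology is the
  product topology.
\<close>

lemma continuous_map_into_realization:
  assumes cont: "\<And>v. continuous_map D euclideanreal (\<lambda>p. h p v)"
    and "finite V"
    and img: "\<And>p. p \<in> topspace D \<Longrightarrow> \<exists>\<rho>\<in>L. \<rho> \<subseteq> V \<and> h p \<in> closed_simplex \<rho>"
  shows "continuous_map D (realization L) h"
  unfolding continuous_map_closedin
proof (intro conjI allI impI)
  show "h \<in> topspace D \<rightarrow> topspace (realization L)"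
    using img by auto
next
  fix C assume C: "closedin (realization L) C"
  have h: "continuous_map D (powertop_real UNIV) h"
    using cont by (simp add: continuous_map_componentwise_UNIV)
  let ?F = "{\<rho>\<in>L. \<rho> \<subseteq> V}"
  have "closedin D {p \<in> topspace D. h p \<in> C \<inter> closed_simplex \<rho>}" if "\<rho> \<in> ?F" for \<rho>
  proof (rule closedin_continuous_map_preimage[OF h])
    have "closedin (subtopology (powertop_real UNIV) (closed_simplex \<rho>)) (C \<inter> closed_simplex \<rho>)"
      using C that unfolding closedin_realization closed_simplex_topology_def by blast
    moreover have "finite \<rho>"
      using that \<open>finite V\<close> finite_subset by blast
    ultimately show "closedin (powertop_real UNIV) (C \<inter> closed_simplex \<rho>)"
      using closedin_closed_simplex closedin_trans_full by blast
  qed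
  moreover have "finite ?F"
    using \<open>finite V\<close> by (auto intro: finite_subset[of _ "Pow V"])
  ultimately have "closedin D (\<Union>\<rho>\<in>?F. {p \<in> topspace D. h p \<in> C \<inter> closed_simplex \<rho>})"
    by (intro closedin_Union) auto
  moreover have "(\<Union>\<rho>\<in>?F. {p \<in> topspace D. h p \<in> C \<inter> closed_simplex \<rho>})
      = {p \<in> topspace D. h p \<in> C}"
    using img by blast
  ultimately show "closedin D {p \<in> topspace D. h p \<in> C}"
    by simp
qed

subsection \<open>Pushing superlevel sets\<close>

text \<open>The inserted 0 is the value when \<open>b\<close> vanishes off \<open>T\<close>. It also
  keeps the maximum nonnegative, so that a set containing a zero of \<open>b\<close> gets weight 0
  below.\<close>

definition outer_max :: "('v \<Rightarrow> real) \<Rightarrow> 'v set \<Rightarrow> real" where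
  "outer_max b T = Max (insert 0 (b ` {v. b v \<noteq> 0 \<and> v \<notin> T}))"

text \<open>
  For finitely supported \<open>b\<close> and finite nonempty \<open>T\<close> the weight is positive exactly when \<open>T\<close> is a
  superlevel set \<open>{v. b v \<ge> s}\<close> with \<open>s > 0\<close>.
\<close>

definition level_weight :: "('v \<Rightarrow> real) \<Rightarrow> 'v set \<Rightarrow> real" where
  "level_weight b T = (\<Prod>y\<in>T. max 0 (b y - outer_max b T))"

text \<open>The sets of positive weight form a flag, as for a point of the barycentric subdivision.
  The weights act as unnormalised coordinates there, and \<open>c\<close> as a vertex map on the
  subdivision.\<close>

definition level_push :: "('v set \<Rightarrow> 'v) \<Rightarrow> ('v \<Rightarrow> real) \<Rightarrow> 'v \<Rightarrow> real" where
  "level_push c b v = (\<Sum>T | T \<noteq> {} \<and> T \<subseteq> {u. b u \<noteq> 0} \<and> c T = v. level_weight b T)"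

lemma outer_max_eq:
  assumes "\<And>v. v \<notin> S \<Longrightarrow> b v = 0"
  shows "outer_max b T = Max (insert 0 (b ` (S - T)))"
proof -
  have "insert 0 (b ` {v. b v \<noteq> 0 \<and> v \<notin> T}) = insert 0 (b ` (S - T))"
  proof (intro equalityI subsetI)
    fix x assume "x \<in> insert 0 (b ` {v. b v \<noteq> 0 \<and> v \<notin> T})"
    then show "x \<in> insert 0 (b ` (S - T))"
      using assms by blast
  next
    fix x assume "x \<in> insert 0 (b ` (S - T))"
    then show "x \<in> insert 0 (b ` {v. b v \<noteq> 0 \<and> v \<notin> T})"
      by (cases "x = 0") auto
  qed
  then show ?thesis
    by (simp add: outer_max_def)
qed

lemma outer_max_nonneg:
  assumes "finite {v. b v \<noteq> 0}"
  shows "0 \<le> outer_max b T"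
  unfolding outer_max_def
  by (rule Max_ge) (auto intro: finite_subset[OF _ assms])

lemma outer_max_ge:
  assumes "finite {v. b v \<noteq> 0}" "v \<notin> T"
  shows "b v \<le> outer_max b T"
proof (cases "b v = 0")
  case True
  then show ?thesis using outer_max_nonneg[OF assms(1)] by simp
next
  case False
  then show ?thesis
    unfolding outer_max_def
    by (intro Max_ge) (use assms in \<open>auto intro: finite_subset[OF _ assms(1)]\<close>)
qed

lemma level_weight_nonneg: "0 \<le> level_weight b T"
  unfolding level_weight_def by (rule prod_nonneg) simp

lemma level_weight_nonzeroD:
  assumes "finite T" "level_weight b T \<noteq> 0" "y \<in> T"
  shows "outer_max b T < b y"
proof (rule ccontr)
  assume "\<not> outer_max b T < b y"
  then have "max 0 (b y - outer_max b T) = 0"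
    by simp
  then have "level_weight b T = 0"
    unfolding level_weight_def using assms(1,3) by (metis prod_zero)
  then show False
    using assms(2) by simp
qed

text \<open>The support of \<open>b\<close> varies with the point; continuity needs a fixed index
  set. The additional sets \<open>T\<close> contain a zero of \<open>b\<close>, and their weight
  vanishes because \<open>outer_max\<close> is nonnegative.\<close>

lemma level_push_eq:
  assumes "finite S" "\<And>v. v \<notin> S \<Longrightarrow> b v = 0"
  shows "level_push c b v = (\<Sum>T | T \<noteq> {} \<and> T \<subseteq> S \<and> c T = v. level_weight b T)"
  unfolding level_push_def
proof (rule sum.mono_neutral_left)
  show "finite {T. T \<noteq> {} \<and> T \<subseteq> S \<and> c T = v}"
    by (rule finite_subset[of _ "Pow S"]) (use assms in auto)
  show "{T. T \<noteq> {} \<and> T \<subseteq> {u. b u \<noteq> 0} \<and> c T = v} \<subseteq> {T. T \<noteq> {} \<and> T \<subseteq> S \<and> c T = v}"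
    using assms(2) by blast
  have fin: "finite {u. b u \<noteq> 0}"
    by (rule finite_subset[OF _ assms(1)]) (use assms(2) in blast)
  show "\<forall>T\<in>{T. T \<noteq> {} \<and> T \<subseteq> S \<and> c T = v} - {T. T \<noteq> {} \<and> T \<subseteq> {u. b u \<noteq> 0} \<and> c T = v}.
          level_weight b T = 0"
  proof
    fix T
    assume T: "T \<in> {T. T \<noteq> {} \<and> T \<subseteq> S \<and> c T = v}
        - {T. T \<noteq> {} \<and> T \<subseteq> {u. b u \<noteq> 0} \<and> c T = v}"
    then obtain y where y: "y \<in> T" "b y = 0"
      by blast
    have "finite T"
      using T assms(1) finite_subset by blast
    then show "level_weight b T = 0"
      using level_weight_nonzeroD[of T b y] outer_max_nonneg[OF fin, of T] y by fastforce
  qed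
qed

lemma level_push_nonneg: "0 \<le> level_push c b v"
  unfolding level_push_def by (intro sum_nonneg level_weight_nonneg)

lemma level_push_zero: "level_push c (\<lambda>_. 0) v = 0"
  unfolding level_push_def by (rule sum.neutral) auto

lemma level_push_nonzeroE:
  assumes "finite {u. b u \<noteq> 0}" "level_push c b v \<noteq> 0"
  obtains T where "T \<noteq> {}" "T \<subseteq> {u. b u \<noteq> 0}" "c T = v" "\<And>y. y \<in> T \<Longrightarrow> outer_max b T < b y"
proof -
  obtain T where T: "T \<noteq> {}" "T \<subseteq> {u. b u \<noteq> 0}" "c T = v" "level_weight b T \<noteq> 0"
    using assms(2) unfolding level_push_def by (auto elim: sum.not_neutral_contains_not_neutral)
  moreover have "finite T"
    using T(2) assms(1) finite_subset by blast
  ultimately show thesis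
    using that level_weight_nonzeroD by metis
qed

text \<open>\<open>Z\<close> is the top level set. Only finitely many nonzero values occur off it,
  all below \<open>M\<close>, so there is a gap and \<open>Z\<close> has positive weight. This later
  makes normalisation possible.\<close>

lemma level_push_pos:
  assumes fin: "finite {u. b u \<noteq> 0}" and le: "\<And>u. b u \<le> M" and "0 < M"
    and Z: "Z = {u. b u = M}" "Z \<noteq> {}"
  shows "0 < level_push c b (c Z)"
  unfolding level_push_def
proof (rule sum_pos2)
  show "finite {T. T \<noteq> {} \<and> T \<subseteq> {u. b u \<noteq> 0} \<and> c T = c Z}"
    by (rule finite_subset[of _ "Pow {u. b u \<noteq> 0}"]) (use fin in auto)
  show "Z \<in> {T. T \<noteq> {} \<and> T \<subseteq> {u. b u \<noteq> 0} \<and> c T = c Z}"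
    using \<open>0 < M\<close> Z by auto
  have "outer_max b Z < M"
    unfolding outer_max_def
  proof (subst Max_less_iff)
    show "finite (insert 0 (b ` {v. b v \<noteq> 0 \<and> v \<notin> Z}))"
      by (auto intro: finite_subset[OF _ fin])
    show "\<forall>x\<in>insert 0 (b ` {v. b v \<noteq> 0 \<and> v \<notin> Z}). x < M"
      using le \<open>0 < M\<close> Z(1) by (auto simp: less_le)
  qed simp
  then show "0 < level_weight b Z"
    unfolding level_weight_def by (intro prod_pos) (use Z(1) in auto)
qed (rule level_weight_nonneg)

lemma continuous_map_Max_insert_0:
  assumes "finite S" "\<And>u. u \<in> S \<Longrightarrow> continuous_map D euclideanreal (\<lambda>p. b p u)"
  shows "continuous_map D euclideanreal (\<lambda>p. Max (insert 0 (b p ` S)))"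
  using assms
proof (induction S rule: finite_induct)
  case (insert u S)
  have "Max (insert 0 (b p ` insert u S)) = max (b p u) (Max (insert 0 (b p ` S)))" for p
    using insert.hyps(1) by (simp add: insert_commute[of 0])
  then show ?case
    using insert by (auto intro: continuous_map_real_max)
qed simp

text \<open>Over the fixed finite set \<open>S\<close> the push is a finite sum of finite products
  of maxima and differences of coordinates.\<close>

lemma continuous_map_level_push:
  assumes "finite S" and cont: "\<And>u. continuous_map D euclideanreal (\<lambda>p. b p u)"
    and b0: "\<And>p u. p \<in> topspace D \<Longrightarrow> u \<notin> S \<Longrightarrow> b p u = 0"
  shows "continuous_map D euclideanreal (\<lambda>p. level_push c (b p) v)"
proof (rule continuous_map_eq)
  let ?m = "\<lambda>p T. Max (insert 0 (b p ` (S - T)))"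
  show "continuous_map D euclideanreal
          (\<lambda>p. \<Sum>T | T \<noteq> {} \<and> T \<subseteq> S \<and> c T = v. \<Prod>y\<in>T. max 0 (b p y - ?m p T))"
  proof (rule continuous_map_sum)
    show "finite {T. T \<noteq> {} \<and> T \<subseteq> S \<and> c T = v}"
      by (rule finite_subset[of _ "Pow S"]) (use assms in auto)
    fix T assume "T \<in> {T. T \<noteq> {} \<and> T \<subseteq> S \<and> c T = v}"
    then have "finite T"
      using \<open>finite S\<close> finite_subset by blast
    moreover have "continuous_map D euclideanreal (\<lambda>p. ?m p T)"
      using assms(1) cont by (intro continuous_map_Max_insert_0) auto
    ultimately show "continuous_map D euclideanreal (\<lambda>p. \<Prod>y\<in>T. max 0 (b p y - ?m p T))"
      using cont by (intro continuous_map_prod continuous_map_real_max continuous_map_diff) auto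
  qed
  fix p assume "p \<in> topspace D"
  then have "u \<notin> S \<Longrightarrow> b p u = 0" for u
    using b0 by blast
  then show "(\<Sum>T | T \<noteq> {} \<and> T \<subseteq> S \<and> c T = v. \<Prod>y\<in>T. max 0 (b p y - ?m p T))
      = level_push c (b p) v"
    by (simp add: level_push_eq[OF \<open>finite S\<close>] level_weight_def outer_max_eq[of S "b p"])
qed

section \<open>Normalisation to barycentric coordinates and the sliding map\<close>

definition normalize_sum :: "('v \<Rightarrow> real) \<Rightarrow> 'v \<Rightarrow> real" where
  "normalize_sum q = (\<lambda>v. q v / (\<Sum>u | q u \<noteq> 0. q u))"

lemma normalize_sum_eq:
  assumes "finite V" "\<And>v. v \<notin> V \<Longrightarrow> q v = 0"
  shows "normalize_sum q v = q v / (\<Sum>u\<in>V. q u)"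
proof -
  have "(\<Sum>u | q u \<noteq> 0. q u) = (\<Sum>u\<in>V. q u)"
    by (rule sum.mono_neutral_left) (use assms in auto)
  then show ?thesis
    by (simp add: normalize_sum_def)
qed

lemma normalize_sum_in_closed_simplex:
  assumes "finite V" "\<And>v. v \<notin> V \<Longrightarrow> q v = 0" "\<And>v. 0 \<le> q v" "0 < (\<Sum>u\<in>V. q u)"
  shows "normalize_sum q \<in> closed_simplex V"
  using assms
  by (auto simp: closed_simplex_def normalize_sum_eq[OF assms(1,2)] simp flip: sum_divide_distrib)

lemma normalize_sum_closed_simplex:
  assumes "finite V" "t \<in> closed_simplex V"
  shows "normalize_sum t = t"
  using assms by (auto simp: closed_simplex_def normalize_sum_eq[OF assms(1)])

lemma closed_simplex_le_1:
  assumes "finite \<sigma>" "t \<in> closed_simplex \<sigma>"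
  shows "t v \<le> 1"
proof (cases "v \<in> \<sigma>")
  case True
  then have "t v \<le> (\<Sum>v\<in>\<sigma>. t v)"
    using assms by (intro member_le_sum) (auto simp: closed_simplex_def)
  then show ?thesis
    using assms by (simp add: closed_simplex_def)
qed (use assms in \<open>auto simp: closed_simplex_def\<close>)

text \<open>
  The part of \<open>t\<close> off \<open>A\<close> is cut at height \<open>\<theta>\<close>: what lies below is pushed into \<open>A\<close> along the
  choice \<open>c\<close>, what lies above stays. The superlevel sets of the lower part all contain the support
  of the upper part.
\<close>

definition slide :: "'v set \<Rightarrow> ('v set \<Rightarrow> 'v) \<Rightarrow> real \<Rightarrow> ('v \<Rightarrow> real) \<Rightarrow> 'v \<Rightarrow> real" where
  "slide A c \<theta> t v = (if v \<in> A then t v else max 0 (t v - \<theta>))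
     + level_push c (\<lambda>u. if u \<in> A then 0 else min (t u) \<theta>) v"

lemma slide_nonneg:
  assumes "\<And>v. 0 \<le> t v"
  shows "0 \<le> slide A c \<theta> t v"
  using assms by (simp add: slide_def level_push_nonneg)

text \<open>The last assumption covers both \<open>\<theta> = 0\<close> and a point supported in
  \<open>A\<close>: in either case there is nothing to push.\<close>

lemma slide_eq_self:
  assumes "\<And>v. 0 \<le> t v" "0 \<le> \<theta>" "\<And>u. u \<notin> A \<Longrightarrow> min (t u) \<theta> = 0"
  shows "slide A c \<theta> t = t"
proof
  fix v
  have "(\<lambda>u. if u \<in> A then 0 else min (t u) \<theta>) = (\<lambda>_. 0)"
    using assms(3) by auto
  moreover have "max 0 (t v - \<theta>) = t v" if "v \<notin> A"
    using assms(1)[of v] assms(2) assms(3)[OF that] by (auto simp: min_def max_def split: if_splits)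
  ultimately show "slide A c \<theta> t v = t v"
    by (simp add: slide_def level_push_zero)
qed

lemma continuous_map_slide:
  assumes "finite \<rho>"
  shows "continuous_map (prod_topology (top_of_set {0..1}) (closed_simplex_topology \<rho>)) euclideanreal
           (\<lambda>p. slide A c (fst p) (snd p) v)"
proof -
  let ?D = "prod_topology (top_of_set {0..1::real}) (closed_simplex_topology \<rho>)"
  have th: "continuous_map ?D euclideanreal fst"
    using continuous_map_fst continuous_map_into_fulltopology by blast
  have t: "continuous_map ?D euclideanreal (\<lambda>p. snd p u)" for u
  proof -
    have "continuous_map (closed_simplex_topology \<rho>) euclideanreal (\<lambda>t. t u)"
      unfolding closed_simplex_topology_def
      by (intro continuous_map_from_subtopology continuous_map_product_projection) simp
    then show ?thesis
      using continuous_map_compose[OF continuous_map_snd] by (force simp: o_def)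
  qed
  have "continuous_map ?D euclideanreal
      (\<lambda>p. level_push c (\<lambda>u. if u \<in> A then 0 else min (snd p u) (fst p)) v)"
  proof (rule continuous_map_level_push[OF assms])
    show "continuous_map ?D euclideanreal (\<lambda>p. if u \<in> A then 0 else min (snd p u) (fst p))" for u
      using th t by (cases "u \<in> A") (auto intro: continuous_map_real_min)
  qed (auto simp: closed_simplex_def)
  moreover have "continuous_map ?D euclideanreal
      (\<lambda>p. if v \<in> A then snd p v else max 0 (snd p v - fst p))"
    using th t by (cases "v \<in> A") (auto intro!: continuous_map_real_max continuous_map_diff)
  ultimately show ?thesis
    unfolding slide_def by (intro continuous_map_add)
qed

subsection \<open>Deformation onto a full subcomplex\<close>

text \<open>In \<open>push_simplex\<close>, \<open>Z\<close> stands for the top level set of the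
  part of a point that is being pushed, and \<open>T\<close> for its possible superlevel sets. All
  their choices must span a simplex together with \<open>Z\<close> and the old vertices in
  \<open>A\<close>.\<close>

locale pushable_complex =
  fixes K :: "'v set set" and A :: "'v set" and c :: "'v set \<Rightarrow> 'v"
  assumes finite_simplex: "\<rho> \<in> K \<Longrightarrow> finite \<rho>"
    and face: "\<rho> \<in> K \<Longrightarrow> \<rho>' \<subseteq> \<rho> \<Longrightarrow> \<rho>' \<noteq> {} \<Longrightarrow> \<rho>' \<in> K"
    and push_in: "\<rho> \<in> K \<Longrightarrow> T \<subseteq> \<rho> - A \<Longrightarrow> T \<noteq> {} \<Longrightarrow> c T \<in> A"
    and push_simplex: "\<rho> \<in> K \<Longrightarrow> Z \<subseteq> \<rho> - A \<Longrightarrow> Z \<noteq> {} \<Longrightarrow>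
      (\<rho> \<inter> A) \<union> c ` {T. Z \<subseteq> T \<and> T \<subseteq> \<rho> - A} \<union> Z \<in> K"
begin

lemma slide_support:
  assumes \<rho>: "\<rho> \<in> K" and t: "t \<in> closed_simplex \<rho>" and \<theta>: "0 \<le> \<theta>" "\<theta> \<le> 1"
  shows "\<exists>\<rho>'\<in>K. \<rho>' \<subseteq> \<rho> \<union> c ` Pow \<rho> \<and> (\<forall>v. v \<notin> \<rho>' \<longrightarrow> slide A c \<theta> t v = 0)
           \<and> (\<exists>v\<in>\<rho>'. 0 < slide A c \<theta> t v) \<and> (\<theta> = 1 \<longrightarrow> \<rho>' \<subseteq> A)"
proof -
  have t0: "0 \<le> t v" and t_out: "v \<notin> \<rho> \<Longrightarrow> t v = 0" and t_sum: "(\<Sum>v\<in>\<rho>. t v) = 1" for v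
    using t by (auto simp: closed_simplex_def)
  have fin: "finite \<rho>"
    using finite_simplex \<rho> by blast
  define b where "b = (\<lambda>u. if u \<in> A then 0 else min (t u) \<theta>)"
  have "b u = 0" if "u \<notin> \<rho> - A" for u
    using t_out[of u] that \<theta>(1) by (auto simp: b_def)
  then have b_supp: "{u. b u \<noteq> 0} \<subseteq> \<rho> - A"
    by blast
  then have fin_b: "finite {u. b u \<noteq> 0}"
    using fin finite_subset by blast
  show ?thesis
  proof (cases "\<forall>u. b u = 0")
    \<comment> \<open>Nothing is pushed, so \<open>t\<close> stays put and its own support is the
      required face.\<close>
    case True
    then have self: "slide A c \<theta> t = t"
      using t0 \<theta>(1) by (intro slide_eq_self) (auto simp: b_def split: if_splits)
    let ?\<rho>' = "{v\<in>\<rho>. t v \<noteq> 0}"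
    have "\<exists>v\<in>\<rho>. t v \<noteq> 0"
      using t_sum by (metis sum.neutral zero_neq_one)
    moreover have "?\<rho>' \<subseteq> A" if "\<theta> = 1"
      using True that by (auto simp: b_def min_def split: if_splits)
    ultimately show ?thesis
      unfolding self using t0 t_out face[OF \<rho>, of ?\<rho>']
      by (intro bexI[of _ ?\<rho>']) (auto simp: less_le)
  next
    case False
    have b0: "0 \<le> b u" for u
      using t0 \<theta>(1) by (simp add: b_def)
    define M where "M = Max (b ` (\<rho> - A))"
    define Z where "Z = {u. b u = M}"
    obtain u0 where u0: "b u0 \<noteq> 0" "u0 \<in> \<rho> - A"
      using False b_supp by blast
    have M_le: "b u \<le> M" if "u \<in> \<rho> - A" for u
      unfolding M_def using fin that by (intro Max_ge) auto
    have "M \<in> b ` (\<rho> - A)"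
      unfolding M_def by (rule Max_in) (use fin u0 in auto)
    then have "Z \<noteq> {}"
      unfolding Z_def by blast
    have "0 < M"
      using M_le[OF u0(2)] b0[of u0] u0(1) by linarith
    have le: "b u \<le> M" for u
      using M_le b_supp \<open>0 < M\<close> by (cases "b u = 0") auto
    have Z_sub: "Z \<subseteq> \<rho> - A"
      using b_supp \<open>0 < M\<close> unfolding Z_def by force
    let ?T = "{T. Z \<subseteq> T \<and> T \<subseteq> \<rho> - A}"
    define \<rho>' where "\<rho>' = (\<rho> \<inter> A) \<union> c ` ?T \<union> (if \<theta> = 1 then {} else Z)"
    have cZ: "c Z \<in> \<rho>'"
      using Z_sub unfolding \<rho>'_def by blast
    have "\<rho>' \<in> K"
      by (rule face[OF push_simplex[OF \<rho> Z_sub \<open>Z \<noteq> {}\<close>]]) (use cZ in \<open>auto simp: \<rho>'_def\<close>)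
    moreover have "\<rho>' \<subseteq> \<rho> \<union> c ` Pow \<rho>"
      unfolding \<rho>'_def using Z_sub by auto
    moreover have "slide A c \<theta> t v = 0" if v: "v \<notin> \<rho>'" for v
    proof -
      have "level_push c b v = 0"
      proof (rule ccontr)
        assume "level_push c b v \<noteq> 0"
        then obtain T where T: "T \<noteq> {}" "T \<subseteq> {u. b u \<noteq> 0}" "c T = v"
          "\<And>y. y \<in> T \<Longrightarrow> outer_max b T < b y"
          using level_push_nonzeroE[OF fin_b] by blast
        \<comment> \<open>A point of \<open>Z\<close> outside \<open>T\<close> would force
          \<open>outer_max b T\<close> up to the maximum \<open>M\<close>, leaving no room for the
          larger values of \<open>b\<close> on the nonempty set \<open>T\<close>.\<close>
        have "Z \<subseteq> T"
        proof
          fix z assume z: "z \<in> Z"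
          show "z \<in> T"
          proof (rule ccontr)
            assume "z \<notin> T"
            then have "M \<le> outer_max b T"
              using outer_max_ge[OF fin_b] z by (auto simp: Z_def)
            then show False
              using T(1,4) le by (meson all_not_in_conv leD le_less_trans)
          qed
        qed
        then have "v \<in> c ` ?T"
          using T(2,3) b_supp by blast
        then show False
          using v unfolding \<rho>'_def by blast
      qed
      moreover have "(if v \<in> A then t v else max 0 (t v - \<theta>)) = 0"
      proof (cases "v \<in> A")
        case True
        then show ?thesis
          using v t_out unfolding \<rho>'_def by auto
      next
        case False
        \<comment> \<open>A coordinate above the cut has \<open>b v = \<theta>\<close>, the largest
          value that \<open>b\<close> can take, so \<open>v\<close> lies in the top level set
          \<open>Z\<close>.\<close>
        have "t v \<le> \<theta>"
        proof (rule ccontr)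
          assume *: "\<not> t v \<le> \<theta>"
          then have "b v = \<theta>"
            using False by (simp add: b_def)
          moreover have "M \<le> \<theta>"
            using \<open>M \<in> b ` (\<rho> - A)\<close> by (auto simp: b_def)
          ultimately have "v \<in> Z"
            using le[of v] by (simp add: Z_def)
          moreover have "\<theta> \<noteq> 1"
            using * closed_simplex_le_1[OF fin t, of v] by auto
          ultimately show False
            using v unfolding \<rho>'_def by auto
        qed
        then show ?thesis
          using False by simp
      qed
      ultimately show ?thesis
        by (simp add: slide_def b_def)
    qed
    moreover have "0 < slide A c \<theta> t (c Z)"
    proof -
      have "0 < level_push c b (c Z)"
        by (rule level_push_pos[OF fin_b le \<open>0 < M\<close> Z_def \<open>Z \<noteq> {}\<close>])
      moreover have "0 \<le> (if c Z \<in> A then t (c Z) else max 0 (t (c Z) - \<theta>))"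
        using t0 by simp
      ultimately show ?thesis
        unfolding slide_def b_def by linarith
    qed
    moreover have "\<rho>' \<subseteq> A" if "\<theta> = 1"
      using that push_in[OF \<rho>] \<open>Z \<noteq> {}\<close> unfolding \<rho>'_def by auto
    ultimately show ?thesis
      using cZ by blast
  qed
qed

definition flow :: "real \<times> ('v \<Rightarrow> real) \<Rightarrow> 'v \<Rightarrow> real" where
  "flow = (\<lambda>(\<theta>, t). normalize_sum (slide A c \<theta> t))"

lemma flow_in_simplex:
  assumes \<rho>: "\<rho> \<in> K" and t: "t \<in> closed_simplex \<rho>" and \<theta>: "0 \<le> \<theta>" "\<theta> \<le> 1"
  shows "\<exists>\<rho>'\<in>K. \<rho>' \<subseteq> \<rho> \<union> c ` Pow \<rho> \<and> flow (\<theta>, t) \<in> closed_simplex \<rho>' \<and> (\<theta> = 1 \<longrightarrow> \<rho>' \<subseteq> A)"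
proof -
  have t0: "0 \<le> t v" for v
    using t by (auto simp: closed_simplex_def)
  obtain \<rho>' where \<rho>': "\<rho>' \<in> K" "\<rho>' \<subseteq> \<rho> \<union> c ` Pow \<rho>" "\<theta> = 1 \<longrightarrow> \<rho>' \<subseteq> A"
    and out: "\<And>v. v \<notin> \<rho>' \<Longrightarrow> slide A c \<theta> t v = 0" and pos: "\<exists>v\<in>\<rho>'. 0 < slide A c \<theta> t v"
    using slide_support[OF assms] by blast
  have "flow (\<theta>, t) \<in> closed_simplex \<rho>'"
    unfolding flow_def prod.case
  proof (rule normalize_sum_in_closed_simplex)
    show "finite \<rho>'"
      by (rule finite_simplex[OF \<rho>'(1)])
    obtain v where "v \<in> \<rho>'" "0 < slide A c \<theta> t v"
      using pos by blast
    then show "0 < (\<Sum>u\<in>\<rho>'. slide A c \<theta> t u)"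
      by (rule sum_pos2[OF \<open>finite \<rho>'\<close>]) (rule slide_nonneg[OF t0])
  qed (use out slide_nonneg[OF t0] in auto)
  then show ?thesis
    using \<rho>' by blast
qed

text \<open>On one simplex the normalising sum can be taken over the fixed finite set
  \<open>?V\<close>. There it is continuous and positive, so the quotient is continuous.\<close>

lemma continuous_map_flow_coordinate:
  assumes \<rho>: "\<rho> \<in> K"
  shows "continuous_map (prod_topology (top_of_set {0..1}) (closed_simplex_topology \<rho>)) euclideanreal
           (\<lambda>p. flow p v)" (is "continuous_map ?D _ _")
proof (rule continuous_map_eq)
  let ?V = "\<rho> \<union> c ` Pow \<rho>"
  have finV: "finite ?V"
    using finite_simplex[OF \<rho>] by simp
  have out: "slide A c \<theta> t u = 0" if "u \<notin> ?V" "t \<in> closed_simplex \<rho>" "0 \<le> \<theta>" "\<theta> \<le> 1" for \<theta> t u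
    using slide_support[OF \<rho> that(2-4)] that(1) by (meson subsetD)
  have pos: "0 < (\<Sum>u\<in>?V. slide A c \<theta> t u)"
    if t: "t \<in> closed_simplex \<rho>" "0 \<le> \<theta>" "\<theta> \<le> 1" for \<theta> t
  proof -
    have t0: "0 \<le> t v" for v
      using t by (auto simp: closed_simplex_def)
    obtain v where "v \<in> ?V" "0 < slide A c \<theta> t v"
      using slide_support[OF \<rho> t] by (meson subsetD)
    then show ?thesis
      by (rule sum_pos2[OF finV]) (rule slide_nonneg[OF t0])
  qed
  show "continuous_map ?D euclideanreal
      (\<lambda>p. slide A c (fst p) (snd p) v / (\<Sum>u\<in>?V. slide A c (fst p) (snd p) u))"
  proof (rule continuous_map_real_divide)
    show "continuous_map ?D euclideanreal (\<lambda>p. slide A c (fst p) (snd p) v)"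
      by (rule continuous_map_slide[OF finite_simplex[OF \<rho>]])
    show "continuous_map ?D euclideanreal (\<lambda>p. \<Sum>u\<in>?V. slide A c (fst p) (snd p) u)"
      by (rule continuous_map_sum[OF finV]) (rule continuous_map_slide[OF finite_simplex[OF \<rho>]])
    fix p assume "p \<in> topspace ?D"
    then show "(\<Sum>u\<in>?V. slide A c (fst p) (snd p) u) \<noteq> 0"
      using pos[of "snd p" "fst p"] by (auto simp: less_le)
  qed
  fix p assume p: "p \<in> topspace ?D"
  have "slide A c (fst p) (snd p) u = 0" if "u \<notin> ?V" for u
    using out[OF that, of "snd p" "fst p"] p by auto
  from normalize_sum_eq[OF finV this]
  show "slide A c (fst p) (snd p) v / (\<Sum>u\<in>?V. slide A c (fst p) (snd p) u) = flow p v"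
    unfolding flow_def case_prod_beta by (rule sym)
qed

lemma continuous_map_flow:
  "continuous_map (prod_topology (top_of_set {0..1}) (realization K)) (realization K) flow"
proof (rule continuous_map_prod_realizationI)
  show "locally_compact_space (top_of_set {0..1::real})"
    by (simp add: compact_imp_locally_compact_space compact_space_subtopology)
  show "Hausdorff_space (top_of_set {0..1::real})"
    by (simp add: Hausdorff_space_subtopology)
  fix \<rho> assume \<rho>: "\<rho> \<in> K"
  show "continuous_map (prod_topology (top_of_set {0..1}) (closed_simplex_topology \<rho>))
          (realization K) flow"
  proof (rule continuous_map_into_realization[OF continuous_map_flow_coordinate[OF \<rho>]])
    show "finite (\<rho> \<union> c ` Pow \<rho>)"
      using finite_simplex[OF \<rho>] by simp
    fix p assume "p \<in> topspace (prod_topology (top_of_set {0..1::real}) (closed_simplex_topology \<rho>))"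
    then show "\<exists>\<rho>'\<in>K. \<rho>' \<subseteq> \<rho> \<union> c ` Pow \<rho> \<and> flow p \<in> closed_simplex \<rho>'"
      using flow_in_simplex[OF \<rho>, of "snd p" "fst p"] by (cases p) auto
  qed
qed

lemma flow_0:
  assumes "t \<in> topspace (realization K)"
  shows "flow (0, t) = t"
proof -
  obtain \<rho> where \<rho>: "\<rho> \<in> K" "t \<in> closed_simplex \<rho>"
    using assms by auto
  then have "slide A c 0 t = t"
    by (intro slide_eq_self) (auto simp: closed_simplex_def)
  then show ?thesis
    using normalize_sum_closed_simplex[OF finite_simplex] \<rho> by (simp add: flow_def)
qed

lemma flow_1_fixed:
  assumes "t \<in> topspace (realization K)" "\<And>v. v \<notin> A \<Longrightarrow> t v = 0"
  shows "flow (1, t) = t"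
proof -
  obtain \<rho> where \<rho>: "\<rho> \<in> K" "t \<in> closed_simplex \<rho>"
    using assms by auto
  then have "slide A c 1 t = t"
    using assms(2) by (intro slide_eq_self) (auto simp: closed_simplex_def)
  then show ?thesis
    using normalize_sum_closed_simplex[OF finite_simplex] \<rho> by (simp add: flow_def)
qed

end

section \<open>Realizations of injective vertex maps\<close>

lemma realization_map_inj:
  assumes "inj f"
  shows "realization_map f t w = (if w \<in> range f then t (inv f w) else 0)"
proof (cases "w \<in> range f")
  case True
  then obtain v where v: "w = f v"
    by blast
  have "{u. t u \<noteq> 0 \<and> f u = w} = (if t v = 0 then {} else {v})"
    using assms v by (auto dest: injD)
  then show ?thesis
    using v assms by (simp add: realization_map_def)
next
  case False
  then have "{u. t u \<noteq> 0 \<and> f u = w} = {}"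
    by auto
  then show ?thesis
    unfolding realization_map_def using False by (metis sum.empty)
qed

lemma realization_map_in_closed_simplex:
  assumes "inj f" "t \<in> closed_simplex \<sigma>"
  shows "realization_map f t \<in> closed_simplex (f ` \<sigma>)"
proof -
  have "(\<Sum>w\<in>f ` \<sigma>. realization_map f t w) = (\<Sum>v\<in>\<sigma>. realization_map f t (f v))"
    using assms(1) by (simp add: sum.reindex inj_on_subset)
  also have "\<dots> = (\<Sum>v\<in>\<sigma>. t v)"
    using assms(1) by (simp add: realization_map_inj)
  finally show ?thesis
    using assms by (auto simp: closed_simplex_def realization_map_inj[OF assms(1)] image_iff)
qed

lemma continuous_map_realization_map:
  assumes "inj f" "\<And>\<sigma>. \<sigma> \<in> E \<Longrightarrow> finite \<sigma> \<and> f ` \<sigma> \<in> K"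
  shows "continuous_map (realization E) (realization K) (realization_map f)"
proof (rule continuous_map_realizationI)
  fix \<sigma> assume \<sigma>: "\<sigma> \<in> E"
  show "continuous_map (closed_simplex_topology \<sigma>) (realization K) (realization_map f)"
  proof (rule continuous_map_into_realization)
    show "continuous_map (closed_simplex_topology \<sigma>) euclideanreal (\<lambda>t. realization_map f t w)" for w
      unfolding realization_map_inj[OF assms(1)] closed_simplex_topology_def
      by (cases "w \<in> range f")
        (auto intro!: continuous_map_from_subtopology continuous_map_product_projection)
    show "finite (f ` \<sigma>)"
      using assms(2)[OF \<sigma>] by simp
    fix t assume "t \<in> topspace (closed_simplex_topology \<sigma>)"
    then have "realization_map f t \<in> closed_simplex (f ` \<sigma>)"
      using realization_map_in_closed_simplex[OF assms(1)] by simp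
    then show "\<exists>\<rho>\<in>K. \<rho> \<subseteq> f ` \<sigma> \<and> realization_map f t \<in> closed_simplex \<rho>"
      using assms(2)[OF \<sigma>] by blast
  qed
qed

lemma realization_map_id_eq: "realization_map id = id"
  by (rule ext) (simp add: realization_map_id)

lemma continuous_map_realization_inclusion:
  assumes "K \<subseteq> L" "\<And>\<sigma>. \<sigma> \<in> K \<Longrightarrow> finite \<sigma>"
  shows "continuous_map (realization K) (realization L) id"
  using continuous_map_realization_map[of id K L] assms by (auto simp: realization_map_id_eq)

text \<open>On points carried by \<open>range f\<close>, precomposition with \<open>f\<close> is the
  inverse of \<open>realization_map f\<close>.\<close>

lemma comp_in_closed_simplex:
  assumes "inj f" "u \<in> closed_simplex \<rho>" "\<rho> \<subseteq> range f"
  shows "u \<circ> f \<in> closed_simplex (f -` \<rho>)" "realization_map f (u \<circ> f) = u"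
proof -
  have "f ` (f -` \<rho>) = \<rho>"
    using assms(3) by blast
  then have "(\<Sum>v\<in>f -` \<rho>. u (f v)) = (\<Sum>w\<in>\<rho>. u w)"
    using sum.reindex[of f "f -` \<rho>" u] assms(1) by (simp add: inj_on_subset)
  then show "u \<circ> f \<in> closed_simplex (f -` \<rho>)"
    using assms(2) by (auto simp: closed_simplex_def)
  show "realization_map f (u \<circ> f) = u"
  proof
    fix w
    have "u w = 0" if "w \<notin> range f"
      using assms(2,3) that unfolding closed_simplex_def by blast
    then show "realization_map f (u \<circ> f) w = u w"
      by (simp add: realization_map_inj[OF assms(1)] f_inv_into_f)
  qed
qed

text \<open>\<open>E\<close> is the full subcomplex of \<open>K\<close> on \<open>A\<close>, read
  back through \<open>f\<close>. At time 1 the flow lands in that subcomplex, which gives the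
  retraction, and the flow itself is the homotopy.\<close>

lemma (in pushable_complex) deformation_retraction:
  assumes f: "inj f" "range f = A"
  defines "E \<equiv> {\<sigma>. f ` \<sigma> \<in> K}"
  shows "\<exists>r. continuous_map (realization K) (realization E) r
           \<and> (\<forall>s\<in>topspace (realization E). r (realization_map f s) = s)
           \<and> homotopic_with (\<lambda>_. True) (realization K) (realization K) (realization_map f \<circ> r) id"
proof (intro exI conjI ballI)
  define r where "r = (\<lambda>t. flow (1, t) \<circ> f)"
  have flow1: "\<exists>\<rho>'\<in>K. \<rho>' \<subseteq> \<rho> \<union> c ` Pow \<rho> \<and> \<rho>' \<subseteq> range f \<and> flow (1, t) \<in> closed_simplex \<rho>'"
    if "\<rho> \<in> K" "t \<in> closed_simplex \<rho>" for \<rho> t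
    using flow_in_simplex[OF that, of 1] f(2) by auto
  show "continuous_map (realization K) (realization E) r"
  proof (rule continuous_map_realizationI)
    fix \<rho> assume \<rho>: "\<rho> \<in> K"
    show "continuous_map (closed_simplex_topology \<rho>) (realization E) r"
    proof (rule continuous_map_into_realization)
      show "continuous_map (closed_simplex_topology \<rho>) euclideanreal (\<lambda>t. r t v)" for v
      proof -
        have "continuous_map (closed_simplex_topology \<rho>)
            (prod_topology (top_of_set {0..1}) (closed_simplex_topology \<rho>)) (\<lambda>t. (1::real, id t))"
          by (intro continuous_map_pairedI) (auto simp: continuous_map_const)
        from continuous_map_compose[OF this continuous_map_flow_coordinate[OF \<rho>, of "f v"]]
        show ?thesis
          by (simp add: o_def r_def)
      qed
      show "finite (f -` (\<rho> \<union> c ` Pow \<rho>))"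
        using finite_simplex[OF \<rho>] f(1) by (intro finite_vimageI) auto
      fix t assume "t \<in> topspace (closed_simplex_topology \<rho>)"
      then have "t \<in> closed_simplex \<rho>"
        by simp
      from flow1[OF \<rho> this] obtain \<rho>' where \<rho>': "\<rho>' \<in> K" "\<rho>' \<subseteq> \<rho> \<union> c ` Pow \<rho>" "\<rho>' \<subseteq> range f"
        and flow: "flow (1, t) \<in> closed_simplex \<rho>'"
        by blast
      have "f ` (f -` \<rho>') = \<rho>'"
        using \<rho>'(3) by blast
      then have "f -` \<rho>' \<in> E"
        using \<rho>'(1) by (simp add: E_def)
      moreover have "r t \<in> closed_simplex (f -` \<rho>')"
        unfolding r_def by (rule comp_in_closed_simplex(1)[OF f(1) flow \<rho>'(3)])
      ultimately show "\<exists>\<sigma>\<in>E. \<sigma> \<subseteq> f -` (\<rho> \<union> c ` Pow \<rho>) \<and> r t \<in> closed_simplex \<sigma>"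
        by (intro bexI[of _ "f -` \<rho>'"] conjI vimage_mono[OF \<rho>'(2)])
    qed
  qed
  show "r (realization_map f s) = s" if s: "s \<in> topspace (realization E)" for s
  proof -
    obtain \<sigma> where \<sigma>: "f ` \<sigma> \<in> K" "s \<in> closed_simplex \<sigma>"
      using s by (auto simp: E_def)
    have "flow (1, realization_map f s) = realization_map f s"
    proof (rule flow_1_fixed)
      show "realization_map f s \<in> topspace (realization K)"
        using realization_map_in_closed_simplex[OF f(1) \<sigma>(2)] \<sigma>(1) by auto
    qed (simp add: realization_map_inj[OF f(1)] f(2))
    then show ?thesis
      using f(1) by (auto simp: r_def realization_map_inj[OF f(1)])
  qed
  have "homotopic_with (\<lambda>_. True) (realization K) (realization K) id (realization_map f \<circ> r)"
  proof (subst homotopic_with, simp, intro exI conjI ballI)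
    show "continuous_map (prod_topology (top_of_set {0..1}) (realization K)) (realization K) flow"
      by (rule continuous_map_flow)
    fix t assume t: "t \<in> topspace (realization K)"
    show "flow (0, t) = id t"
      using flow_0[OF t] by simp
    obtain \<rho> where "\<rho> \<in> K" "t \<in> closed_simplex \<rho>"
      using t by auto
    from flow1[OF this] obtain \<rho>' where "flow (1, t) \<in> closed_simplex \<rho>'" "\<rho>' \<subseteq> range f"
      by blast
    then have "realization_map f (flow (1, t) \<circ> f) = flow (1, t)"
      by (rule comp_in_closed_simplex(2)[OF f(1)])
    then show "flow (1, t) = (realization_map f \<circ> r) t"
      by (simp add: r_def)
  qed simp
  then show "homotopic_with (\<lambda>_. True) (realization K) (realization K) (realization_map f \<circ> r) id"
    by (rule homotopic_with_symD)
qed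

subsection \<open>The complex of bicliques of a relation\<close>

text \<open>This symmetry transfers every result about the \<open>E\<close> side to the
  \<open>F\<close> side.\<close>

lemma dowker_F_converse: "dowker_F X Y R = dowker_E Y X (R\<inverse>)"
  by (simp add: dowker_E_def dowker_F_def)

text \<open>The embeddings \<open>f\<close> and \<open>g\<close> are parameters so that both sides
  can be exchanged without changing the complex. If one side is empty, the product condition is
  vacuous and the other side must still be a simplex of its Dowker complex.\<close>

definition biclique_complex ::
    "('a \<Rightarrow> 'v) \<Rightarrow> ('b \<Rightarrow> 'v) \<Rightarrow> 'a set \<Rightarrow> 'b set \<Rightarrow> ('a \<times> 'b) set \<Rightarrow> 'v set set" where
  "biclique_complex f g X Y R = {\<rho>. finite \<rho> \<and> \<rho> \<noteq> {} \<and> (f -` \<rho>) \<times> (g -` \<rho>) \<subseteq> R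
     \<and> (f -` \<rho> \<noteq> {} \<longrightarrow> f -` \<rho> \<in> dowker_E X Y R)
     \<and> (g -` \<rho> \<noteq> {} \<longrightarrow> g -` \<rho> \<in> dowker_F X Y R)}"

lemma biclique_complex_converse: "biclique_complex g f Y X (R\<inverse>) = biclique_complex f g X Y R"
  unfolding biclique_complex_def dowker_F_converse by auto

lemma biclique_complex_mono:
  assumes "R \<subseteq> R'"
  shows "biclique_complex f g X Y R \<subseteq> biclique_complex f g X Y R'"
  unfolding biclique_complex_def using dowker_mono[OF assms, THEN subsetD] assms
  by (intro Collect_mono) blast

text \<open>The choice for \<open>T\<close> is a witness related to all of \<open>T\<close>. If
  \<open>T\<close> contains \<open>Z\<close>, that witness is related to \<open>Z\<close>, and so
  are the old vertices on the \<open>f\<close> side, since \<open>Z\<close> lies in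
  \<open>\<rho>\<close>.\<close>

lemma pushable_biclique_complex:
  assumes f: "inj f" and disj: "range f \<inter> range g = {}"
    and cover: "range f \<union> range g = UNIV"
  shows "pushable_complex (biclique_complex f g X Y R) (range f)
           (\<lambda>T. f (SOME x. x \<in> X \<and> (\<forall>y\<in>g -` T. (x, y) \<in> R)))"
    (is "pushable_complex ?K _ (\<lambda>T. f (?w T))")
proof
  show "finite \<rho>" if "\<rho> \<in> ?K" for \<rho>
    using that by (simp add: biclique_complex_def)
  have dE: "\<sigma>' \<in> dowker_E X Y R" if "\<sigma> \<in> dowker_E X Y R" "\<sigma>' \<subseteq> \<sigma>" "\<sigma>' \<noteq> {}" for \<sigma> \<sigma>'
    using that finite_subset unfolding dowker_E_def by blast
  have dF: "\<tau>' \<in> dowker_F X Y R" if "\<tau> \<in> dowker_F X Y R" "\<tau>' \<subseteq> \<tau>" "\<tau>' \<noteq> {}" for \<tau> \<tau>'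
    using that finite_subset unfolding dowker_F_def by blast
  show "\<rho>' \<in> ?K" if \<rho>: "\<rho> \<in> ?K" and sub: "\<rho>' \<subseteq> \<rho>" and "\<rho>' \<noteq> {}" for \<rho> \<rho>'
  proof -
    have "f -` \<rho>' \<subseteq> f -` \<rho>" "g -` \<rho>' \<subseteq> g -` \<rho>" "finite \<rho>'"
      using \<rho> sub finite_subset by (auto simp: biclique_complex_def)
    moreover from this have "(f -` \<rho>') \<times> (g -` \<rho>') \<subseteq> R"
      using \<rho> unfolding biclique_complex_def by blast
    moreover have "f -` \<rho>' \<in> dowker_E X Y R" if "f -` \<rho>' \<noteq> {}"
      using that dE[of "f -` \<rho>"] \<rho> calculation(1) unfolding biclique_complex_def by blast
    moreover have "g -` \<rho>' \<in> dowker_F X Y R" if "g -` \<rho>' \<noteq> {}"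
      using that dF[of "g -` \<rho>"] \<rho> calculation(2) unfolding biclique_complex_def by blast
    ultimately show ?thesis
      using \<open>\<rho>' \<noteq> {}\<close> unfolding biclique_complex_def by blast
  qed
  show "f (?w T) \<in> range f" for T
    by blast
  show "(\<rho> \<inter> range f) \<union> (\<lambda>T. f (?w T)) ` {T. Z \<subseteq> T \<and> T \<subseteq> \<rho> - range f} \<union> Z \<in> ?K"
    (is "?\<rho>' \<in> _")
    if \<rho>: "\<rho> \<in> ?K" and Z: "Z \<subseteq> \<rho> - range f" "Z \<noteq> {}" for \<rho> Z
  proof -
    let ?T = "{T. Z \<subseteq> T \<and> T \<subseteq> \<rho> - range f}"
    \<comment> \<open>\<open>Z\<close> avoids \<open>range f\<close>, so it consists of
      \<open>g\<close>-vertices. The vertex \<open>z\<close> later serves as the common neighbour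
      that puts the enlarged \<open>f\<close> side into \<open>dowker_E X Y R\<close>.\<close>
    obtain z where z: "g z \<in> Z"
      using Z cover by blast
    have zF: "g -` \<rho> \<in> dowker_F X Y R"
      using \<rho> z Z unfolding biclique_complex_def by blast
    have gZ: "g -` Z \<in> dowker_F X Y R"
      using dF[OF zF, of "g -` Z"] Z(1) z by blast
    have w: "?w T \<in> X \<and> (\<forall>y\<in>g -` T. (?w T, y) \<in> R)" if "T \<in> ?T" for T
    proof (rule someI_ex)
      show "\<exists>x. x \<in> X \<and> (\<forall>y\<in>g -` T. (x, y) \<in> R)"
        using zF that unfolding dowker_F_def by blast
    qed
    have fin: "finite \<rho>"
      using \<rho> by (simp add: biclique_complex_def)
    have "finite ?T"
      by (rule finite_subset[of _ "Pow \<rho>"]) (use fin in auto)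
    have f': "f -` ?\<rho>' = f -` \<rho> \<union> ?w ` ?T"
      using f Z(1) by (auto dest: injD)
    have g': "g -` ?\<rho>' = g -` Z"
      using disj by auto
    have R: "(f -` ?\<rho>') \<times> (g -` ?\<rho>') \<subseteq> R"
      unfolding f' g' using w \<rho> Z(1) unfolding biclique_complex_def by blast
    have "finite ?\<rho>'"
      using fin \<open>finite ?T\<close> Z(1) finite_subset by auto
    moreover have "f -` ?\<rho>' \<in> dowker_E X Y R"
    proof -
      have "f -` \<rho> \<subseteq> X"
        using \<rho> unfolding biclique_complex_def dowker_E_def by blast
      then have "f -` ?\<rho>' \<subseteq> X"
        unfolding f' using w by blast
      moreover have "f -` ?\<rho>' \<noteq> {}"
        unfolding f' using Z(1) by blast
      moreover have "finite (f -` ?\<rho>')"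
        by (rule finite_vimageI[OF \<open>finite ?\<rho>'\<close> f])
      moreover have "z \<in> Y"
        using gZ z unfolding dowker_F_def by blast
      moreover have "\<forall>x\<in>f -` ?\<rho>'. (x, z) \<in> R"
        using R z by blast
      ultimately show ?thesis
        unfolding dowker_E_def by blast
    qed
    moreover have "g -` ?\<rho>' \<in> dowker_F X Y R"
      unfolding g' by (rule gZ)
    moreover have "?\<rho>' \<noteq> {}"
      using z by blast
    ultimately show ?thesis
      using R unfolding biclique_complex_def mem_Collect_eq by (intro conjI impI)
  qed
qed

text \<open>A simplex of \<open>K\<close> inside \<open>range f\<close> has empty \<open>g\<close>
  side, so the full subcomplex on \<open>range f\<close> is a copy of the Dowker complex
  \<open>dowker_E X Y R\<close>.\<close>

lemma biclique_complex_deformation_retraction: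
  fixes f :: "'a \<Rightarrow> 'v" and g :: "'b \<Rightarrow> 'v" and R :: "('a \<times> 'b) set"
    and X :: "'a set" and Y :: "'b set"
  assumes f: "inj f" and disj: "range f \<inter> range g = {}"
    and cover: "range f \<union> range g = UNIV"
  defines "K \<equiv> biclique_complex f g X Y R"
  shows "continuous_map (realization (dowker_E X Y R)) (realization K) (realization_map f) \<and>
    (\<exists>r. continuous_map (realization K) (realization (dowker_E X Y R)) r
           \<and> (\<forall>s\<in>topspace (realization (dowker_E X Y R)). r (realization_map f s) = s)
           \<and> homotopic_with (\<lambda>_. True) (realization K) (realization K) (realization_map f \<circ> r) id)"
proof -
  have "f ` \<sigma> \<in> K \<longleftrightarrow> \<sigma> \<in> dowker_E X Y R" for \<sigma>
  proof -
    have "f -` f ` \<sigma> = \<sigma>"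
      using f by (simp add: inj_vimage_image_eq)
    moreover have "g -` f ` \<sigma> = {}"
      using disj by blast
    ultimately show ?thesis
      by (auto simp: K_def biclique_complex_def dowker_E_def)
  qed
  then have E: "{\<sigma>. f ` \<sigma> \<in> K} = dowker_E X Y R"
    by blast
  interpret pushable_complex K "range f" "\<lambda>T. f (SOME x. x \<in> X \<and> (\<forall>y\<in>g -` T. (x, y) \<in> R))"
    unfolding K_def by (rule pushable_biclique_complex[OF f disj cover])
  have "continuous_map (realization (dowker_E X Y R)) (realization K) (realization_map f)"
    by (rule continuous_map_realization_map[OF f]) (use E in \<open>auto simp: dowker_E_def\<close>)
  then show ?thesis
    using deformation_retraction[OF f refl] unfolding E by blast
qed

section \<open>Homotopies between composites, and the comparison of two relations\<close>

lemma homotopic_with_cong_left: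
  assumes "homotopic_with (\<lambda>_. True) S T f g" "continuous_map S T f'"
    "\<And>x. x \<in> topspace S \<Longrightarrow> f' x = f x"
  shows "homotopic_with (\<lambda>_. True) S T f' g"
  using homotopic_with_trans[OF homotopic_with_equal assms(1)] assms(2,3) by blast

text \<open>Replacing \<open>h\<close> by the identity leaves \<open>r \<circ> i\<close>, which is
  the identity on \<open>F\<close>. Both composites of the equivalence between the two Dowker
  complexes have this shape.\<close>

lemma homotopic_with_cancel_deformation:
  assumes h: "homotopic_with (\<lambda>_. True) K K h id" and i: "continuous_map F K i"
    and r: "continuous_map K F r" and ri: "\<forall>s\<in>topspace F. r (i s) = s"
  shows "homotopic_with (\<lambda>_. True) F F (r \<circ> h \<circ> i) id"
proof -
  have "homotopic_with (\<lambda>_. True) F F (r \<circ> (h \<circ> i)) (r \<circ> (id \<circ> i))"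
    by (intro homotopic_with_compose_continuous_map_left[OF _ r]
        homotopic_with_compose_continuous_map_right[OF h i]) auto
  moreover have "homotopic_with (\<lambda>_. True) F F (r \<circ> (id \<circ> i)) id"
    by (rule homotopic_with_equal) (use ri continuous_map_compose[OF i r] in auto)
  ultimately show ?thesis
    unfolding o_assoc by (rule homotopic_with_trans)
qed

theorem theorem3:
  fixes X :: "'a set" and Y :: "'b set"
    and leX :: "('a \<times> 'a) set" and leY :: "('b \<times> 'b) set"
    and R R' :: "('a \<times> 'b) set"
  assumes "linear_order_on X leX" and "linear_order_on Y leY"
    and "R \<noteq> {}" and "R' \<noteq> {}"
    and "R \<subseteq> R'" and "R' \<subseteq> X \<times> Y"
  shows "\<exists>\<Gamma> \<Gamma>'.
      homotopy_equivalence_map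
        (realization (dowker_F X Y R)) (realization (dowker_E X Y R)) \<Gamma> \<and>
      homotopy_equivalence_map
        (realization (dowker_F X Y R')) (realization (dowker_E X Y R')) \<Gamma>' \<and>
      homotopic_with (\<lambda>_. True)
        (realization (dowker_F X Y R)) (realization (dowker_E X Y R'))
        (realization_map (id :: 'a \<Rightarrow> 'a) \<circ> \<Gamma>) (\<Gamma>' \<circ> realization_map (id :: 'b \<Rightarrow> 'b))"
proof -
  let ?K = "\<lambda>S. realization (biclique_complex Inl Inr X Y S)"
  let ?E = "\<lambda>S. realization (dowker_E X Y S)" and ?F = "\<lambda>S. realization (dowker_F X Y S)"
  let ?i = "realization_map (Inl :: 'a \<Rightarrow> 'a + 'b)"
    and ?j = "realization_map (Inr :: 'b \<Rightarrow> 'a + 'b)"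
  have sum: "range (Inl :: 'a \<Rightarrow> 'a + 'b) \<inter> range (Inr :: 'b \<Rightarrow> 'a + 'b) = {}"
    "range (Inl :: 'a \<Rightarrow> 'a + 'b) \<union> range (Inr :: 'b \<Rightarrow> 'a + 'b) = UNIV"
    by (auto simp: UNIV_sum)
  then have sum': "range (Inr :: 'b \<Rightarrow> 'a + 'b) \<inter> range (Inl :: 'a \<Rightarrow> 'a + 'b) = {}"
    "range (Inr :: 'b \<Rightarrow> 'a + 'b) \<union> range (Inl :: 'a \<Rightarrow> 'a + 'b) = UNIV"
    by blast+
  have i: "continuous_map (?E S) (?K S) ?i"
    and ex_r: "\<exists>r. continuous_map (?K S) (?E S) r \<and> (\<forall>s\<in>topspace (?E S). r (?i s) = s)
        \<and> homotopic_with (\<lambda>_. True) (?K S) (?K S) (?i \<circ> r) id" for S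
    using biclique_complex_deformation_retraction[OF inj_Inl sum, of X Y S] by blast+
  \<comment> \<open>The same retraction result is applied with the sides swapped and the converse
    relation, which leaves the biclique complex unchanged.\<close>
  have j: "continuous_map (?F S) (?K S) ?j"
    and ex_q: "\<exists>q. continuous_map (?K S) (?F S) q \<and> (\<forall>s\<in>topspace (?F S). q (?j s) = s)
        \<and> homotopic_with (\<lambda>_. True) (?K S) (?K S) (?j \<circ> q) id" for S
    using biclique_complex_deformation_retraction[OF inj_Inr sum', of Y X "S\<inverse>"]
    unfolding biclique_complex_converse dowker_F_converse[symmetric] by blast+
  obtain r where r: "\<And>S. continuous_map (?K S) (?E S) (r S)"
      "\<And>S. \<forall>s\<in>topspace (?E S). r S (?i s) = s"
      "\<And>S. homotopic_with (\<lambda>_. True) (?K S) (?K S) (?i \<circ> r S) id"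
    using ex_r by metis
  obtain q where q: "\<And>S. continuous_map (?K S) (?F S) (q S)"
      "\<And>S. \<forall>s\<in>topspace (?F S). q S (?j s) = s"
      "\<And>S. homotopic_with (\<lambda>_. True) (?K S) (?K S) (?j \<circ> q S) id"
    using ex_q by metis
  \<comment> \<open>The homotopy inverse is \<open>q S \<circ> ?i\<close>. Reassociating puts
    \<open>?i \<circ> r S\<close> or \<open>?j \<circ> q S\<close> in the middle, where it
    cancels.\<close>
  have equiv: "homotopy_equivalence_map (?F S) (?E S) (r S \<circ> ?j)" for S
    unfolding homotopy_equivalence_map_def
  proof (intro conjI exI)
    show "continuous_map (?F S) (?E S) (r S \<circ> ?j)" "continuous_map (?E S) (?F S) (q S \<circ> ?i)"
      using i j r(1) q(1) continuous_map_compose by blast+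
    show "homotopic_with (\<lambda>_. True) (?F S) (?F S) (q S \<circ> ?i \<circ> (r S \<circ> ?j)) id"
      using homotopic_with_cancel_deformation[of "?K S" "?i \<circ> r S" "?F S" ?j "q S"] r(3) j q(1,2)
      by (simp add: o_assoc)
    show "homotopic_with (\<lambda>_. True) (?E S) (?E S) (r S \<circ> ?j \<circ> (q S \<circ> ?i)) id"
      using homotopic_with_cancel_deformation[of "?K S" "?j \<circ> q S" "?E S" ?i "r S"] q(3) i r(1,2)
      by (simp add: o_assoc)
  qed
  have inclE: "continuous_map (?E R) (?E R') id"
    using dowker_mono(1)[OF \<open>R \<subseteq> R'\<close>]
    by (rule continuous_map_realization_inclusion) (simp add: dowker_E_def)
  have inclK: "continuous_map (?K R) (?K R') id"
    using biclique_complex_mono[OF \<open>R \<subseteq> R'\<close>]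
    by (rule continuous_map_realization_inclusion) (simp add: biclique_complex_def)
  \<comment> \<open>The formula for \<open>?i\<close> does not depend on the relation, so
    \<open>r R'\<close> undoes it on the larger realization, which contains the point
    \<open>r R (?j s)\<close>.\<close>
  have rR: "r R' (?i (r R (?j s))) = r R (?j s)" if "s \<in> topspace (?F R)" for s
  proof -
    have "r R (?j s) \<in> topspace (?E R)"
      using that continuous_map_image_subset_topspace[OF continuous_map_compose[OF j r(1)], of R]
      by (force simp del: topspace_realization)
    then have "r R (?j s) \<in> topspace (?E R')"
      using continuous_map_image_subset_topspace[OF inclE] by auto
    then show ?thesis
      by (rule r(2)[rule_format])
  qed
  \<comment> \<open>The deformation of \<open>?K R\<close> is restricted along \<open>?j\<close>,
    carried into \<open>?K R'\<close> by the inclusion, and pushed down by \<open>r R'\<close>. By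
    \<open>rR\<close> its left end is \<open>r R \<circ> ?j\<close> on the space.\<close>
  have "homotopic_with (\<lambda>_. True) (?F R) (?E R')
      (r R' \<circ> (id \<circ> (?i \<circ> r R \<circ> ?j))) (r R' \<circ> (id \<circ> (id \<circ> ?j)))"
    by (intro homotopic_with_compose_continuous_map_left[OF _ r(1)]
        homotopic_with_compose_continuous_map_left[OF _ inclK]
        homotopic_with_compose_continuous_map_right[OF r(3) j]) auto
  then have "homotopic_with (\<lambda>_. True) (?F R) (?E R') (r R \<circ> ?j) (r R' \<circ> (id \<circ> (id \<circ> ?j)))"
  proof (rule homotopic_with_cong_left)
    show "continuous_map (?F R) (?E R') (r R \<circ> ?j)"
      using continuous_map_compose[OF continuous_map_compose[OF j r(1)] inclE] by (simp add: o_def)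
  qed (simp add: rR)
  then have "homotopic_with (\<lambda>_. True) (?F R) (?E R')
      (realization_map id \<circ> (r R \<circ> ?j)) ((r R' \<circ> ?j) \<circ> realization_map id)"
    by (simp add: realization_map_id_eq)
  with equiv show ?thesis
    by blast
qed

end
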